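(* Let $(S,\preccurlyeq)$ be a preordered semiring of polynomial growth and let $(X,\Phi)$ be an abstract asymptotic spectrum for $(S,\preccurlyeq)$. Then there is a unique homeomorphism $h:X\to\Delta(S,\preccurlyeq)$ such that $\Phi(s)=\operatorname{ev}_s\circ h$ for all $s\in S$.
   Context: A semiring is a set with commutative and associative operations $+$ and $\cdot$ with neutral elements $0$ and $1$ respectively, such that $0\cdot a=0$ and $a(b+c)=ab+ac$. Semiring homomorphisms preserve $0,1,+,\cdot$. $\mathbb{N}=\{0,1,2,\ldots\}$. A preordered semiring is a pair $(S,\preccurlyeq)$ with $S$ a semiring and $\preccurlyeq$ a reflexive transitive relation on $S$ such that $0\preccurlyeq 1$ and $a\preccurlyeq b$ implies $a+c\preccurlyeq b+c$ and $ac\preccurlyeq bc$ for all $c\in S$. We write $b\succcurlyeq a$ for $a\preccurlyeq b$. An element $u\in S$ is power universal if $u\succcurlyeq 1$ and for every $x\in S\setminus\{0\}$ there is a $k\in\mathbb{N}$ such that $x\preccurlyeq u^k$ and $u^kx\succcurlyeq 1$. $S$ is of polynomial growth if it has a power universal element. Asymptotic preorder: for $(S,\preccurlyeq)$ of polynomial growth and $u$ power universal, $x\succsim y$ iff there is a sequence $(k_n)_{n\in\mathbb{N}}$ of nonnegative integers with $\lim_{n\to\infty}k_n/n=0$ and $u^{k_n}x^n\succcurlyeq y^n$ for all $n\in\mathbb{N}$ (this relation does not depend on the choice of $u$). The spectrum $\Delta(S,\preccurlyeq)$ is the set of semiring homomorphisms $f:S\to\mathbb{R}_{\ge 0}$ that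 are monotone ($x\preccurlyeq y\implies f(x)\le f(y)$), with the initial topology with respect to the evaluation maps $\operatorname{ev}_s:f\mapsto f(s)$, $s\in S$. For a topological space $X$, $C(X)$ is the ring of continuous real-valued functions on $X$ with the pointwise partial order. An abstract asymptotic spectrum for a preordered semiring $(S,\preccurlyeq)$ of polynomial growth is a pair $(X,\Phi)$ where $X$ is a locally compact topological space and $\Phi:S\to C(X)$ is a semiring homomorphism such that $\Phi(S)$ separates the points of $X$, the image $\Phi(u)$ of every power universal element $u$ is a proper map (preimages of compact sets are compact), and $\forall x,y\in S: x\succsim y\iff\Phi(x)\ge\Phi(y)$. *)

theory Defs
  imports "HOL-Analysis.Analysis"
begin

text \<open>
  Semirings are types of sort \<open>{comm_semiring_0, comm_monoid_mult}\<close>: unlike \<open>comm_semiring_1\<close>,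
  this sort does not require \<open>0 \<noteq> 1\<close>, so the trivial semiring is included.
  The preorder is an explicit relation \<open>le\<close>.
\<close>

definition preordered_semiring :: "('s::{comm_semiring_0, comm_monoid_mult} \<Rightarrow> 's \<Rightarrow> bool) \<Rightarrow> bool" where
  "preordered_semiring le \<longleftrightarrow>
     reflp le \<and> transp le \<and> le 0 1 \<and>
     (\<forall>a b c. le a b \<longrightarrow> le (a + c) (b + c) \<and> le (a * c) (b * c))"

definition power_universal ::
    "('s::{comm_semiring_0, comm_monoid_mult} \<Rightarrow> 's \<Rightarrow> bool) \<Rightarrow> 's \<Rightarrow> bool" where
  "power_universal le u \<longleftrightarrow>
     le 1 u \<and> (\<forall>x. x \<noteq> 0 \<longrightarrow> (\<exists>k::nat. le x (u ^ k) \<and> le 1 (u ^ k * x)))"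

definition polynomial_growth :: "('s::{comm_semiring_0, comm_monoid_mult} \<Rightarrow> 's \<Rightarrow> bool) \<Rightarrow> bool" where
  "polynomial_growth le \<longleftrightarrow> (\<exists>u. power_universal le u)"

text \<open>
  \<open>asymp_ge le x y\<close> is \<open>x \<succsim> y\<close>. The relation does not depend on the power universal
  element \<open>u\<close>, so it is immaterial that \<open>u\<close> is quantified existentially.
\<close>

definition asymp_ge ::
    "('s::{comm_semiring_0, comm_monoid_mult} \<Rightarrow> 's \<Rightarrow> bool) \<Rightarrow> 's \<Rightarrow> 's \<Rightarrow> bool" where
  "asymp_ge le x y \<longleftrightarrow>
     (\<exists>u. power_universal le u \<and>
       (\<exists>k::nat \<Rightarrow> nat. (\<lambda>n. real (k n) / real n) \<longlonglongrightarrow> 0 \<and>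
                       (\<forall>n. le (y ^ n) (u ^ k n * x ^ n))))"

definition spectrum ::
    "('s::{comm_semiring_0, comm_monoid_mult} \<Rightarrow> 's \<Rightarrow> bool) \<Rightarrow> ('s \<Rightarrow> real) set" where
  "spectrum le =
     {f. (\<forall>s. 0 \<le> f s) \<and>
         f 0 = 0 \<and> f 1 = 1 \<and>
         (\<forall>s t. f (s + t) = f s + f t) \<and> (\<forall>s t. f (s * t) = f s * f t) \<and>
         (\<forall>s t. le s t \<longrightarrow> f s \<le> f t)}"

definition ev :: "'s \<Rightarrow> ('s \<Rightarrow> real) \<Rightarrow> real" where
  "ev s f = f s"

definition initial_topology :: "'a set \<Rightarrow> 'b topology \<Rightarrow> ('a \<Rightarrow> 'b) set \<Rightarrow> 'a topology" where
  "initial_topology A T F = topology_generated_by {g -` U \<inter> A | g U. g \<in> F \<and> openin T U}"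

definition spectrum_topology ::
    "('s::{comm_semiring_0, comm_monoid_mult} \<Rightarrow> 's \<Rightarrow> bool) \<Rightarrow> ('s \<Rightarrow> real) topology" where
  "spectrum_topology le = initial_topology (spectrum le) (top_of_set {0..}) (range ev)"

text \<open>
  The points of the space are those of \<open>topspace X\<close>, possibly none. An element of \<open>C(X)\<close> is
  represented by a function that is only relevant on \<open>topspace X\<close>, so equality and order in
  \<open>C(X)\<close> are equality and order pointwise on \<open>topspace X\<close>. Properness is stated as compactness of preimages of compact sets;
  the library's \<open>proper_map\<close> is defined differently.
\<close>

definition abstract_asymptotic_spectrum ::
    "('s::{comm_semiring_0, comm_monoid_mult} \<Rightarrow> 's \<Rightarrow> bool) \<Rightarrow> 'x topology \<Rightarrow> ('s \<Rightarrow> 'x \<Rightarrow> real) \<Rightarrow> bool" where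
  "abstract_asymptotic_spectrum le X \<Phi> \<longleftrightarrow>
     locally_compact_space X \<and>
     (\<forall>s. continuous_map X euclideanreal (\<Phi> s)) \<and>
     (\<forall>p\<in>topspace X. \<Phi> 0 p = 0) \<and>
     (\<forall>p\<in>topspace X. \<Phi> 1 p = 1) \<and>
     (\<forall>s t. \<forall>p\<in>topspace X. \<Phi> (s + t) p = \<Phi> s p + \<Phi> t p) \<and>
     (\<forall>s t. \<forall>p\<in>topspace X. \<Phi> (s * t) p = \<Phi> s p * \<Phi> t p) \<and>
     (\<forall>p\<in>topspace X. \<forall>q\<in>topspace X. p \<noteq> q \<longrightarrow> (\<exists>s. \<Phi> s p \<noteq> \<Phi> s q)) \<and>
     (\<forall>u. power_universal le u \<longrightarrow>
        (\<forall>K. compact K \<longrightarrow> compactin X {p \<in> topspace X. \<Phi> u p \<in> K})) \<and>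
     (\<forall>s t. asymp_ge le s t \<longleftrightarrow> (\<forall>p\<in>topspace X. \<Phi> s p \<ge> \<Phi> t p))"

end

theory Submission
  imports Defs
begin

text \<open>
  The only candidate for \<open>h\<close> sends a point \<open>p\<close> to the evaluation \<open>s \<mapsto> \<Phi> s p\<close>. Monotonicity of
  \<open>\<Phi>\<close> with respect to the asymptotic preorder makes this evaluation a point of the spectrum
  \<open>\<Delta>\<close>, the initial topology makes \<open>h\<close> continuous, and separation of points makes it injective.

  The substance is surjectivity. A point \<open>f\<close> of \<open>\<Delta>\<close> is monotone even for the asymptotic preorder
  (take \<open>n\<close>-th roots), and that preorder is the pointwise order on \<open>Y = h(X)\<close>. Hence \<open>f\<close> is a
  positive functional on the ring of differences \<open>ev s - ev t\<close> restricted to \<open>Y\<close>. Suppose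
  \<open>f \<notin> Y\<close>. On a compact piece \<open>{\<theta> \<in> Y. \<theta> u \<le> C}\<close>, with \<open>C\<close> well above \<open>f u\<close>, finitely many elements
  \<open>s\<close> suffice to distinguish \<open>f\<close> from all \<open>\<theta>\<close>, so a sum of squares of the form
  \<open>(M * ev s - m)\<^sup>2\<close>, where the integer \<open>m\<close> approximates \<open>M * f s\<close>, is small at \<open>f\<close> and large on the
  compact piece; outside of it \<open>ev u\<close> itself is large. Adding a multiple of \<open>ev u\<close> to the sum
  of squares gives a function that is at least some constant on all of \<open>Y\<close> but smaller at \<open>f\<close>,
  which contradicts positivity. This is lemma \<open>mem_of_order_determining\<close>.

  Finally, \<open>h\<close> is open: the set \<open>{\<theta>. \<theta> u < C}\<close> is an open neighbourhood in \<open>\<Delta>\<close> of any of its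
  points, its preimage lies in a compact set, and on compact sets a continuous map into a
  Hausdorff space is closed.
\<close>

section \<open>The asymptotic preorder\<close>

lemma preordered_semiring_refl: "preordered_semiring le \<Longrightarrow> le a a"
  by (simp add: preordered_semiring_def reflp_def)

lemma preordered_semiring_trans: "preordered_semiring le \<Longrightarrow> le a b \<Longrightarrow> le b c \<Longrightarrow> le a c"
  unfolding preordered_semiring_def by (blast dest: transpD)

lemma preordered_semiring_mult_mono:
  assumes "preordered_semiring le" "le a b" "le c d"
  shows "le (a * c) (b * d)"
proof (rule preordered_semiring_trans[OF assms(1)])
  show "le (a * c) (b * c)"
    using assms by (simp add: preordered_semiring_def)
  have "le (c * b) (d * b)"
    using assms by (simp add: preordered_semiring_def)
  then show "le (b * c) (b * d)"
    by (simp add: mult.commute)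
qed

lemma preordered_semiring_power_mono:
  assumes "preordered_semiring le" "le a b"
  shows "le (a ^ n) (b ^ n)"
  by (induction n)
    (use assms in \<open>auto intro: preordered_semiring_refl preordered_semiring_mult_mono\<close>)

lemma preordered_semiring_zero_le:
  assumes "preordered_semiring le"
  shows "le 0 a"
proof -
  have "le (0 * a) (1 * a)"
    using assms unfolding preordered_semiring_def by blast
  then show ?thesis by simp
qed

lemma asymp_ge_of_le:
  assumes "preordered_semiring le" "polynomial_growth le" "le y x"
  shows "asymp_ge le x y"
proof -
  obtain u where "power_universal le u"
    using assms(2) by (auto simp: polynomial_growth_def)
  then show ?thesis
    unfolding asymp_ge_def
    by (intro exI[of _ u] conjI exI[of _ "\<lambda>_. 0"])
      (use assms in \<open>auto intro: preordered_semiring_power_mono\<close>)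
qed

lemma spectrum_add: "f \<in> spectrum le \<Longrightarrow> f (s + t) = f s + f t"
  by (simp add: spectrum_def)

lemma spectrum_mult: "f \<in> spectrum le \<Longrightarrow> f (s * t) = f s * f t"
  by (simp add: spectrum_def)

lemma spectrum_power:
  assumes "f \<in> spectrum le"
  shows "f (s ^ n) = f s ^ n"
  by (induction n) (use assms in \<open>auto simp: spectrum_def\<close>)

text \<open>
  Applying \<open>f\<close> to \<open>y ^ n \<preceq> u ^ k n * x ^ n\<close> and dividing logarithms by \<open>n\<close> leaves the error term
  \<open>k n / n * ln (f u)\<close>, which vanishes in the limit.
\<close>

lemma spectrum_asymp_mono:
  assumes f: "f \<in> spectrum le" and xy: "asymp_ge le x y"
  shows "f y \<le> f x"
proof -
  obtain u k where u: "power_universal le u"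
    and k: "(\<lambda>n. real (k n) / real n) \<longlonglongrightarrow> 0"
    and le: "\<And>n. le (y ^ n) (u ^ k n * x ^ n)"
    using xy unfolding asymp_ge_def by blast
  have nonneg: "0 \<le> f s" for s
    using f by (simp add: spectrum_def)
  have "f 1 \<le> f u"
    using f u unfolding spectrum_def power_universal_def by blast
  then have fu: "1 \<le> f u"
    using f by (simp add: spectrum_def)
  have ineq: "f y ^ n \<le> f u ^ k n * f x ^ n" for n
  proof -
    have "f (y ^ n) \<le> f (u ^ k n * x ^ n)"
      using f le[of n] unfolding spectrum_def by blast
    also have "\<dots> = f (u ^ k n) * f (x ^ n)"
      using f by (simp add: spectrum_def)
    finally show ?thesis
      using f by (simp add: spectrum_power)
  qed
  consider "f x = 0" | "f y = 0" | "0 < f x" "0 < f y"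
    using nonneg[of x] nonneg[of y] by linarith
  then show ?thesis
  proof cases
    case 1
    then show ?thesis using ineq[of 1] by simp
  next
    case 2
    then show ?thesis using nonneg by simp
  next
    case 3
    have bound: "ln (f y) \<le> real (k n) / real n * ln (f u) + ln (f x)" if "n \<ge> 1" for n
    proof -
      have "ln (f y ^ n) \<le> ln (f u ^ k n * f x ^ n)"
        using ineq[of n] 3 fu by (subst ln_le_cancel_iff) auto
      then have "real n * ln (f y) \<le> real (k n) * ln (f u) + real n * ln (f x)"
        using 3 fu by (simp add: ln_realpow ln_mult)
      then show ?thesis
        using that by (simp add: field_simps)
    qed
    have "(\<lambda>n. real (k n) / real n * ln (f u) + ln (f x)) \<longlonglongrightarrow> 0 * ln (f u) + ln (f x)"
      by (intro tendsto_intros k)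
    then have "ln (f y) \<le> 0 * ln (f u) + ln (f x)"
      by (rule LIMSEQ_le_const) (use bound in blast)
    then show ?thesis
      using 3 by simp
  qed
qed

section \<open>The topology of the spectrum\<close>

lemma topspace_spectrum_topology: "topspace (spectrum_topology le) = spectrum le"
proof -
  have "openin (top_of_set {0..}) {0::real..}"
    by (metis openin_topspace topspace_euclidean_subtopology)
  moreover have "ev 0 -` {0..} \<inter> spectrum le = spectrum le"
    by (auto simp: ev_def spectrum_def)
  ultimately have "spectrum le \<in> {g -` U \<inter> spectrum le | g U. g \<in> range ev \<and> openin (top_of_set {0..}) U}"
    by blast
  then show ?thesis
    unfolding spectrum_topology_def initial_topology_def topology_generated_by_topspace by blast
qed

lemma openin_spectrum_topology:
  assumes "open U"
  shows "openin (spectrum_topology le) {\<theta> \<in> spectrum le. \<theta> s \<in> U}"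
proof -
  have "openin (top_of_set {0..}) ({0..} \<inter> U)"
    using assms by (simp add: openin_open_Int)
  moreover have "{\<theta> \<in> spectrum le. \<theta> s \<in> U} = ev s -` ({0..} \<inter> U) \<inter> spectrum le"
    by (auto simp: ev_def spectrum_def)
  ultimately show ?thesis
    unfolding spectrum_topology_def initial_topology_def
    by (intro topology_generated_by_Basis) blast
qed

lemma continuous_map_into_spectrum:
  assumes h: "h ` topspace X \<subseteq> spectrum le"
    and cont: "\<And>s. continuous_map X euclideanreal (\<lambda>p. h p s)"
  shows "continuous_map X (spectrum_topology le) h"
  unfolding spectrum_topology_def initial_topology_def continuous_on_generated_topo_iff
proof (intro conjI allI impI)
  fix V assume "V \<in> {g -` U \<inter> spectrum le | g U. g \<in> range ev \<and> openin (top_of_set {0..}) U}"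
  then obtain s U where V: "V = ev s -` U \<inter> spectrum le" and U: "openin (top_of_set {0..}) U"
    by blast
  obtain W where W: "open W" "U = {0..} \<inter> W"
    using U by (auto simp: openin_open)
  have "h -` V \<inter> topspace X = {p \<in> topspace X. h p s \<in> W}"
    using h V W by (auto simp: ev_def spectrum_def)
  then show "openin X (h -` V \<inter> topspace X)"
    using cont[of s] W(1) by (simp add: continuous_map_def)
next
  have "spectrum le = topspace (spectrum_topology le)"
    by (simp add: topspace_spectrum_topology)
  then show "h ` topspace X \<subseteq> \<Union> {g -` U \<inter> spectrum le | g U. g \<in> range ev \<and> openin (top_of_set {0..}) U}"
    using h unfolding spectrum_topology_def initial_topology_def topology_generated_by_topspace
    by simp
qed

lemma Hausdorff_spectrum_topology: "Hausdorff_space (spectrum_topology le)"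
  unfolding Hausdorff_space_def topspace_spectrum_topology
proof (intro allI impI, elim conjE)
  fix f g assume f: "f \<in> spectrum le" and g: "g \<in> spectrum le" and "f \<noteq> g"
  then obtain s where "f s \<noteq> g s" by blast
  then obtain U V where UV: "open U" "open V" "f s \<in> U" "g s \<in> V" "U \<inter> V = {}"
    using hausdorff by metis
  show "\<exists>A B. openin (spectrum_topology le) A \<and> openin (spectrum_topology le) B \<and>
      f \<in> A \<and> g \<in> B \<and> disjnt A B"
    by (intro exI[of _ "{\<theta> \<in> spectrum le. \<theta> s \<in> U}"] exI[of _ "{\<theta> \<in> spectrum le. \<theta> s \<in> V}"])
      (use UV f g openin_spectrum_topology in \<open>auto simp: disjnt_def\<close>)
qed

section \<open>Differences of evaluations\<close>

text \<open>
  The ring of functions on the spectrum that is generated by the evaluation maps. The semiring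
  has no subtraction, so an inequality between polynomial expressions in its elements is
  most easily handled as the nonnegativity of such a function.
\<close>

definition evaluation_difference ::
    "('s::{comm_semiring_0, comm_monoid_mult} \<Rightarrow> 's \<Rightarrow> bool) \<Rightarrow> (('s \<Rightarrow> real) \<Rightarrow> real) \<Rightarrow> bool" where
  "evaluation_difference le g \<longleftrightarrow> (\<exists>s t. \<forall>\<theta>\<in>spectrum le. g \<theta> = \<theta> s - \<theta> t)"

lemma evaluation_difference_ev: "evaluation_difference le (\<lambda>\<theta>. \<theta> s)"
  unfolding evaluation_difference_def
  by (intro exI[of _ s] exI[of _ 0]) (simp add: spectrum_def)

lemma evaluation_difference_one: "evaluation_difference le (\<lambda>_. 1)"
  unfolding evaluation_difference_def
  by (intro exI[of _ 1] exI[of _ 0]) (simp add: spectrum_def)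

lemma evaluation_difference_zero: "evaluation_difference le (\<lambda>_. 0)"
  unfolding evaluation_difference_def
  by (intro exI[of _ 0]) simp

lemma evaluation_difference_diff:
  assumes "evaluation_difference le a" "evaluation_difference le b"
  shows "evaluation_difference le (\<lambda>\<theta>. a \<theta> - b \<theta>)"
proof -
  obtain s t s' t' where "\<forall>\<theta>\<in>spectrum le. a \<theta> = \<theta> s - \<theta> t" "\<forall>\<theta>\<in>spectrum le. b \<theta> = \<theta> s' - \<theta> t'"
    using assms unfolding evaluation_difference_def by blast
  then show ?thesis
    unfolding evaluation_difference_def
    by (intro exI[of _ "s + t'"] exI[of _ "t + s'"]) (simp add: spectrum_def)
qed

lemma evaluation_difference_add:
  assumes "evaluation_difference le a" "evaluation_difference le b"
  shows "evaluation_difference le (\<lambda>\<theta>. a \<theta> + b \<theta>)"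
  using evaluation_difference_diff[OF assms(1)
      evaluation_difference_diff[OF evaluation_difference_zero assms(2)]]
  by simp

lemma evaluation_difference_mult:
  assumes "evaluation_difference le a" "evaluation_difference le b"
  shows "evaluation_difference le (\<lambda>\<theta>. a \<theta> * b \<theta>)"
proof -
  obtain s t where a: "\<And>\<theta>. \<theta> \<in> spectrum le \<Longrightarrow> a \<theta> = \<theta> s - \<theta> t"
    using assms(1) unfolding evaluation_difference_def by blast
  obtain s' t' where b: "\<And>\<theta>. \<theta> \<in> spectrum le \<Longrightarrow> b \<theta> = \<theta> s' - \<theta> t'"
    using assms(2) unfolding evaluation_difference_def by blast
  have "a \<theta> * b \<theta> = \<theta> (s * s' + t * t') - \<theta> (s * t' + t * s')" if "\<theta> \<in> spectrum le" for \<theta>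
    by (simp add: a[OF that] b[OF that] spectrum_add[OF that] spectrum_mult[OF that] algebra_simps)
  then show ?thesis
    unfolding evaluation_difference_def by blast
qed

lemma evaluation_difference_of_nat: "evaluation_difference le (\<lambda>_. real n)"
proof (induction n)
  case 0
  then show ?case using evaluation_difference_zero by simp
next
  case (Suc n)
  then show ?case
    using evaluation_difference_add[OF evaluation_difference_one Suc] by simp
qed

lemma evaluation_difference_sum:
  assumes "finite T" "\<And>i. i \<in> T \<Longrightarrow> evaluation_difference le (a i)"
  shows "evaluation_difference le (\<lambda>\<theta>. \<Sum>i\<in>T. a i \<theta>)"
  using assms
  by (induction T) (simp_all add: evaluation_difference_zero evaluation_difference_add)

lemma spectrum_multiple:
  assumes "\<theta> \<in> spectrum le"
  shows "\<theta> (\<Sum>i<(n::nat). s) = real n * \<theta> s"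
proof (induction n)
  case 0
  then show ?case using assms by (simp add: spectrum_def)
next
  case (Suc n)
  then show ?case by (simp add: spectrum_add[OF assms] algebra_simps)
qed

section \<open>Positive functionals are evaluations\<close>

text \<open>
  If \<open>f\<close> were not in \<open>Y\<close>, a suitable element of the difference ring would be nonnegative on \<open>Y\<close>
  and negative at \<open>f\<close>. Only integer coefficients are available, which is why the real number
  \<open>M * f s\<close> is rounded instead of being subtracted exactly.
\<close>

lemma mem_of_order_determining:
  fixes le :: "'s::{comm_semiring_0, comm_monoid_mult} \<Rightarrow> 's \<Rightarrow> bool"
  assumes Y: "Y \<subseteq> spectrum le" and f: "f \<in> spectrum le"
    and mono: "\<And>s t. (\<And>\<theta>. \<theta> \<in> Y \<Longrightarrow> \<theta> s \<le> \<theta> t) \<Longrightarrow> f s \<le> f t"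
    and compact: "\<And>C. compactin (spectrum_topology le) {\<theta> \<in> Y. \<theta> u \<le> C}"
  shows "f \<in> Y"
proof (rule ccontr)
  assume "f \<notin> Y"
  have pos: "0 \<le> g f" if "evaluation_difference le g" "\<And>\<theta>. \<theta> \<in> Y \<Longrightarrow> 0 \<le> g \<theta>" for g
  proof -
    obtain s t where st: "\<forall>\<theta>\<in>spectrum le. g \<theta> = \<theta> s - \<theta> t"
      using \<open>evaluation_difference le g\<close> unfolding evaluation_difference_def by blast
    have "\<theta> t \<le> \<theta> s" if "\<theta> \<in> Y" for \<theta>
      using st Y that \<open>\<And>\<theta>. \<theta> \<in> Y \<Longrightarrow> 0 \<le> g \<theta>\<close>[OF that] by auto
    then have "f t \<le> f s" by (rule mono)
    then show ?thesis using st f by simp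
  qed
  obtain C :: nat where C: "f u + 1 < real C"
    using reals_Archimedean2 by blast
  define K where "K = {\<theta> \<in> Y. \<theta> u \<le> real C}"
  define far where "far s = {\<theta> \<in> spectrum le. \<theta> s \<in> - cball (f s) 1}" for s
  have far_open: "openin (spectrum_topology le) (far s)" for s
    unfolding far_def by (rule openin_spectrum_topology) auto
  \<comment> \<open>Replacing an element by a multiple of it enlarges the distance between its values beyond 1.\<close>
  have cover: "K \<subseteq> \<Union> (range far)"
  proof
    fix \<theta> assume "\<theta> \<in> K"
    then have \<theta>: "\<theta> \<in> spectrum le" "\<theta> \<noteq> f"
      using Y \<open>f \<notin> Y\<close> by (auto simp: K_def)
    then obtain s where "\<theta> s \<noteq> f s" by blast
    then obtain n :: nat where n: "1 < real n * \<bar>f s - \<theta> s\<bar>"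
      using reals_Archimedean3[of "\<bar>f s - \<theta> s\<bar>"] by auto
    have "\<bar>f (\<Sum>i<n. s) - \<theta> (\<Sum>i<n. s)\<bar> = real n * \<bar>f s - \<theta> s\<bar>"
      by (simp add: spectrum_multiple[OF f] spectrum_multiple[OF \<theta>(1)] abs_mult
          flip: right_diff_distrib)
    then have "\<theta> \<in> far (\<Sum>i<n. s)"
      using n \<theta>(1) by (simp add: far_def dist_real_def)
    then show "\<theta> \<in> \<Union> (range far)" by blast
  qed
  obtain T where T: "finite T" "K \<subseteq> (\<Union>s\<in>T. far s)"
  proof -
    have "compactin (spectrum_topology le) K"
      unfolding K_def by (rule compact)
    then obtain \<F> where \<F>: "finite \<F>" "\<F> \<subseteq> range far" "K \<subseteq> \<Union>\<F>"
      using compactinD[OF _ _ cover] far_open by (metis (no_types, lifting) imageE)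
    obtain T where "finite T" "\<F> = far ` T"
      using finite_subset_image[OF \<F>(1,2)] by blast
    then show ?thesis
      using that[of T] \<F>(3) by simp
  qed
  \<comment> \<open>At \<open>f\<close> each of the \<open>card T\<close> squares contributes at most 1, by rounding, so that
    \<open>r * f u + card T < r * (f u + 1) < r * C\<close>. On \<open>K\<close> some square is at least \<open>(M - 1)\<^sup>2 \<ge> r * C\<close>.\<close>
  define r where "r = real (card T) + 1"
  obtain M :: nat where M: "2 + r * real C < real M"
    using reals_Archimedean2 by blast
  have "r * real C \<ge> 0"
    by (simp add: r_def)
  have M_sq: "r * real C \<le> (real M - 1)\<^sup>2"
  proof -
    have "r * real C \<le> 1 * (real M - 1)" using M by simp
    also have "\<dots> \<le> (real M - 1) * (real M - 1)"
      using M \<open>r * real C \<ge> 0\<close> by (intro mult_right_mono) auto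
    finally show ?thesis by (simp add: power2_eq_square)
  qed
  define m where "m s = nat \<lfloor>real M * f s\<rfloor>" for s
  have m: "\<bar>real M * f s - real (m s)\<bar> \<le> 1" for s
  proof -
    have "0 \<le> real M * f s" using f by (simp add: spectrum_def)
    then show ?thesis unfolding m_def by linarith
  qed
  define g where "g \<theta> = r * \<theta> u + (\<Sum>s\<in>T. (real M * \<theta> s - real (m s)) * (real M * \<theta> s - real (m s)))
      - r * real C" for \<theta>
  have "evaluation_difference le g"
  proof -
    have "r = real (card T + 1)" by (simp add: r_def)
    then show ?thesis
      unfolding g_def
      by (simp only:)
        (intro evaluation_difference_diff evaluation_difference_add evaluation_difference_mult
          evaluation_difference_sum evaluation_difference_of_nat evaluation_difference_ev T(1))
  qed
  moreover have "0 \<le> g \<theta>" if "\<theta> \<in> Y" for \<theta>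
  proof (cases "\<theta> u \<le> real C")
    case True
    then obtain s where s: "s \<in> T" "\<theta> \<in> far s"
      using \<open>\<theta> \<in> Y\<close> T(2) unfolding K_def by blast
    have "1 < \<bar>f s - \<theta> s\<bar>"
      using s by (simp add: far_def dist_real_def)
    then have "real M * 1 \<le> real M * \<bar>f s - \<theta> s\<bar>"
      by (intro mult_left_mono) auto
    also have "\<dots> = \<bar>real M * f s - real M * \<theta> s\<bar>"
      by (simp add: abs_mult flip: right_diff_distrib)
    finally have "real M - 1 \<le> \<bar>real M * \<theta> s - real (m s)\<bar>"
      using m[of s] by linarith
    then have "(real M - 1)\<^sup>2 \<le> (real M * \<theta> s - real (m s))\<^sup>2"
      using M \<open>r * real C \<ge> 0\<close> by (subst abs_le_square_iff[symmetric]) auto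
    also have "\<dots> \<le> (\<Sum>s\<in>T. (real M * \<theta> s - real (m s)) * (real M * \<theta> s - real (m s)))"
      using member_le_sum[of s T "\<lambda>s. (real M * \<theta> s - real (m s)) * (real M * \<theta> s - real (m s))"]
        s T(1) by (simp add: power2_eq_square)
    moreover have "0 \<le> r * \<theta> u"
      using that Y by (auto simp: r_def spectrum_def)
    ultimately show ?thesis
      using M_sq by (simp add: g_def)
  next
    case False
    then have "r * real C \<le> r * \<theta> u"
      by (intro mult_left_mono) (auto simp: r_def)
    moreover have "0 \<le> (\<Sum>s\<in>T. (real M * \<theta> s - real (m s)) * (real M * \<theta> s - real (m s)))"
      by (intro sum_nonneg) simp
    ultimately show ?thesis by (simp add: g_def)
  qed
  ultimately have "0 \<le> g f" by (rule pos)
  moreover have "(\<Sum>s\<in>T. (real M * f s - real (m s)) * (real M * f s - real (m s))) \<le> (\<Sum>s\<in>T. 1)"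
  proof (rule sum_mono)
    fix s
    have "(real M * f s - real (m s))\<^sup>2 \<le> 1"
      using m[of s] by (simp add: abs_square_le_1)
    then show "(real M * f s - real (m s)) * (real M * f s - real (m s)) \<le> 1"
      by (simp add: power2_eq_square)
  qed
  moreover have "r * (f u + 1) < r * real C"
    using C by (intro mult_strict_left_mono) (auto simp: r_def)
  ultimately show False
    by (simp add: g_def r_def algebra_simps)
qed

section \<open>Open maps into Hausdorff spaces\<close>

text \<open>
  Let \<open>z = h p\<close> with \<open>p\<close> in an open set \<open>W\<close>. The neighbourhood \<open>{g < C}\<close> of \<open>z\<close> can only leave
  \<open>h ` W\<close> inside the image of the compact set \<open>{g \<circ> h \<le> C} - W\<close>. This image is closed, because
  the target is Hausdorff, and misses \<open>z\<close>, so removing it leaves a neighbourhood of \<open>z\<close> in \<open>h ` W\<close>.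
\<close>

lemma open_map_of_compact_sublevel_sets:
  fixes g :: "'y \<Rightarrow> real"
  assumes h: "continuous_map X Z h" "inj_on h (topspace X)" "h ` topspace X = topspace Z"
    and Z: "Hausdorff_space Z"
    and g: "\<And>C. openin Z {z \<in> topspace Z. g z < C}"
    and compact: "\<And>C. compactin X {p \<in> topspace X. g (h p) \<le> C}"
  shows "open_map X Z h"
  unfolding open_map_def
proof (intro allI impI)
  fix W assume W: "openin X W"
  have "\<exists>V. openin Z V \<and> z \<in> V \<and> V \<subseteq> h ` W" if z: "z \<in> h ` W" for z
  proof -
    define C where "C = g z + 1"
    define K where "K = {p \<in> topspace X. g (h p) \<le> C}"
    define V where "V = {z \<in> topspace Z. g z < C} - h ` (K - W)"
    have "closedin X (topspace X - W)"
      using W by blast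
    then have "compactin X (K \<inter> (topspace X - W))"
      unfolding K_def using compact compact_Int_closedin by blast
    moreover have "K \<inter> (topspace X - W) = K - W"
      by (auto simp: K_def)
    ultimately have "compactin Z (h ` (K - W))"
      using h(1) by (metis image_compactin)
    then have "closedin Z (h ` (K - W))"
      using Z by (rule compactin_imp_closedin[rotated])
    then have "openin Z V"
      unfolding V_def using g by blast
    moreover have "z \<in> V"
      using z h(2) openin_subset[OF W] by (auto simp: V_def C_def K_def inj_on_def simp flip: h(3))
    moreover have "V \<subseteq> h ` W"
      using h(3) by (force simp: V_def K_def)
    ultimately show ?thesis by blast
  qed
  then show "openin Z (h ` W)"
    by (subst openin_subopen) blast
qed

section \<open>Abstract asymptotic spectra\<close>

text \<open>Values of \<open>\<Phi>\<close> are nonnegative because every element of the semiring is above 0.\<close>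

lemma evaluation_in_spectrum:
  assumes "preordered_semiring le" "polynomial_growth le"
    and "abstract_asymptotic_spectrum le X \<Phi>" and "p \<in> topspace X"
  shows "(\<lambda>s. \<Phi> s p) \<in> spectrum le"
proof -
  have mono: "\<Phi> s p \<le> \<Phi> t p" if "le s t" for s t
    using asymp_ge_of_le[OF assms(1,2) that] assms(3,4)
    unfolding abstract_asymptotic_spectrum_def by blast
  have "0 \<le> \<Phi> s p" for s
    using mono[OF preordered_semiring_zero_le[OF assms(1)]] assms(3,4)
    unfolding abstract_asymptotic_spectrum_def by metis
  then show ?thesis
    using mono assms(3,4) by (simp add: spectrum_def abstract_asymptotic_spectrum_def)
qed

theorem proposition1p4:
  fixes le :: "'s::{comm_semiring_0, comm_monoid_mult} \<Rightarrow> 's \<Rightarrow> bool"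
    and X :: "'x topology"
    and \<Phi> :: "'s \<Rightarrow> 'x \<Rightarrow> real"
  assumes "preordered_semiring le"
    and "polynomial_growth le"
    and "abstract_asymptotic_spectrum le X \<Phi>"
  shows "\<exists>!h. h \<in> extensional (topspace X) \<and>
              homeomorphic_map X (spectrum_topology le) h \<and>
              (\<forall>s. \<forall>p\<in>topspace X. \<Phi> s p = (ev s \<circ> h) p)"
proof (rule ex1I)
  define h where "h = restrict (\<lambda>p s. \<Phi> s p) (topspace X)"
  have h_apply: "h p s = \<Phi> s p" if "p \<in> topspace X" for p s
    using that by (simp add: h_def)
  obtain u where u: "power_universal le u"
    using assms(2) by (auto simp: polynomial_growth_def)
  have cont_\<Phi>: "continuous_map X euclideanreal (\<Phi> s)" for s
    using assms(3) by (simp add: abstract_asymptotic_spectrum_def)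
  have separates: "\<exists>s. \<Phi> s p \<noteq> \<Phi> s q" if "p \<in> topspace X" "q \<in> topspace X" "p \<noteq> q" for p q
    using assms(3) that by (simp add: abstract_asymptotic_spectrum_def)
  have asymp_iff: "asymp_ge le s t \<longleftrightarrow> (\<forall>p\<in>topspace X. \<Phi> s p \<ge> \<Phi> t p)" for s t
    using assms(3) by (simp add: abstract_asymptotic_spectrum_def)
  have into: "h ` topspace X \<subseteq> spectrum le"
    using evaluation_in_spectrum[OF assms] by (auto simp: h_def)
  have cont: "continuous_map X (spectrum_topology le) h"
  proof (rule continuous_map_into_spectrum[OF into])
    fix s
    show "continuous_map X euclideanreal (\<lambda>p. h p s)"
      using cont_\<Phi>[of s] by (rule continuous_map_eq) (simp add: h_apply)
  qed
  have inj: "inj_on h (topspace X)"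
    by (rule inj_onI) (metis h_apply separates)
  have sublevel: "compactin X {p \<in> topspace X. h p u \<le> C}" for C
  proof -
    have "{p \<in> topspace X. h p u \<le> C} = {p \<in> topspace X. \<Phi> u p \<in> {0..C}}"
      using into by (auto simp: h_apply spectrum_def image_subset_iff)
    then show ?thesis
      using assms(3) u unfolding abstract_asymptotic_spectrum_def by (metis compact_Icc)
  qed
  have surj: "h ` topspace X = spectrum le"
  proof (rule antisym[OF into], rule subsetI)
    fix f assume f: "f \<in> spectrum le"
    show "f \<in> h ` topspace X"
    proof (rule mem_of_order_determining[OF into f])
      fix s t assume "\<And>\<theta>. \<theta> \<in> h ` topspace X \<Longrightarrow> \<theta> s \<le> \<theta> t"
      then have "asymp_ge le t s"
        unfolding asymp_iff by (metis h_apply imageI)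
      then show "f s \<le> f t"
        by (rule spectrum_asymp_mono[OF f])
    next
      fix C
      have "{\<theta> \<in> h ` topspace X. \<theta> u \<le> C} = h ` {p \<in> topspace X. h p u \<le> C}"
        by blast
      then show "compactin (spectrum_topology le) {\<theta> \<in> h ` topspace X. \<theta> u \<le> C}"
        using image_compactin[OF sublevel cont] by simp
    qed
  qed
  have "open_map X (spectrum_topology le) h"
  proof (rule open_map_of_compact_sublevel_sets[where g = "\<lambda>\<theta>. \<theta> u"])
    show "openin (spectrum_topology le) {\<theta> \<in> topspace (spectrum_topology le). \<theta> u < C}" for C
      using openin_spectrum_topology[of "{..<C}" le u] by (simp add: topspace_spectrum_topology)
  qed (use cont inj surj sublevel Hausdorff_spectrum_topology in
      \<open>simp_all add: topspace_spectrum_topology\<close>)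
  then have "homeomorphic_map X (spectrum_topology le) h"
    using cont inj surj
    by (simp add: bijective_open_imp_homeomorphic_map topspace_spectrum_topology)
  moreover have "h \<in> extensional (topspace X)"
    by (simp add: h_def)
  ultimately show "h \<in> extensional (topspace X) \<and>
      homeomorphic_map X (spectrum_topology le) h \<and>
      (\<forall>s. \<forall>p\<in>topspace X. \<Phi> s p = (ev s \<circ> h) p)"
    by (simp add: ev_def h_apply)
  fix h' assume h': "h' \<in> extensional (topspace X) \<and>
      homeomorphic_map X (spectrum_topology le) h' \<and>
      (\<forall>s. \<forall>p\<in>topspace X. \<Phi> s p = (ev s \<circ> h') p)"
  show "h' = h"
  proof (rule extensionalityI)
    show "h' p = h p" if "p \<in> topspace X" for p
      using h' that by (intro ext) (simp add: h_apply ev_def)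
  qed (use h' in \<open>auto simp: h_def\<close>)
qed

end
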